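(* Let $(R,f,g)$ be a commutative Krasner $(m,n)$-hyperring with scalar identity $1$, let $S$ be an $n$-ary multiplicative subset of $R$, and let $I$ be a hyperideal of $R$ with $I\cap S=\varnothing$. Then $I$ is an $n$-ary $S$-prime hyperideal of $R$ if and only if there exists $s\in S$ such that for all hyperideals $I_1,\dots,I_n$ of $R$, if $g(I_1^n)\subseteq I$, then $g(s,I_i,1^{(n-2)})\subseteq I$ for some $1\le i\le n$.
   Context: Notation: $x_i^j$ denotes the sequence $x_i,\dots,x_j$ (empty if $j<i$); $x^{(k)}$ denotes $x$ repeated $k$ times; operations are extended to subsets elementwise (taking unions), so $g(I_1^n)=\{g(a_1^n)\mid a_i\in I_i\}$; $m,n\ge 2$ are integers. An $m$-ary hyperoperation on $R$ is a map $f$ from $R^m$ to the nonempty subsets of $R$. $(R,f)$ is a (commutative) canonical $m$-ary hypergroup if $f$ is invariant under permuting its arguments; $f$ is associative, i.e. $f(x_1^{i-1},f(x_i^{m+i-1}),x_{m+i}^{2m-1})$ does not depend on $i$; for all $a_1^{i-1},a_{i+1}^m,b\in R$ there is $x\in R$ with $b\in f(a_1^{i-1},x,a_{i+1}^m)$; there is a unique $0\in R$ with $f(x,0^{(m-1)})=\{x\}$ for all $x$; each $x$ has a unique $-x$ with $0\in f(x,-x,0^{(m-2)})$; and $x\in f(x_1^m)$ implies $x_i\in f(x,-x_1,\dots,-x_{i-1},-x_{i+1},\dots,-x_m)$ for all $i$. A commutative Krasner $(m,n)$-hyperring $(R,f,g)$ is such an $(R,f)$ together with an associative, permutation-invariant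 $n$-ary operation $g:R^n\to R$ that is distributive over $f$ in each argument, i.e. $g(a_1^{i-1},f(x_1^m),a_{i+1}^n)=f(g(a_1^{i-1},x_1,a_{i+1}^n),\dots,g(a_1^{i-1},x_m,a_{i+1}^n))$, and satisfies $g(0,x_2^n)=0$. A scalar identity is an element $1$ with $g(x,1^{(n-1)})=x$ for all $x$. A hyperideal of $R$ is a nonempty $I\subseteq R$ such that $(I,f)$ is an $m$-ary subhypergroup of $(R,f)$ (i.e. $f(x_1^m)\subseteq I$ for $x_1^m\in I$, and $b\in f(b_1^{i-1},x,b_{i+1}^m)$ has a solution $x\in I$ whenever all $b$'s lie in $I$) and $g(x_1^{i-1},I,x_{i+1}^n)\subseteq I$ for all $x_j\in R$ and all $i$. An $n$-ary multiplicative subset is a nonempty $S\subseteq R$ with $g(s_1^n)\in S$ for all $s_1^n\in S$. A hyperideal $I$ with $I\cap S=\varnothing$ is an $n$-ary $S$-prime hyperideal if there exists $s\in S$ such that for all $x_1^n\in R$ with $g(x_1^n)\in I$ one has $g(s,x_i,1^{(n-2)})\in I$ for some $1\le i\le n$. *)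

theory Defs
  imports "HOL-Library.Multiset" "HOL-Library.NList"
begin

text \<open>
  A \<open>k\<close>-ary (hyper)operation on a carrier \<open>R\<close> is a function on lists of which only the values on
  \<open>nlists k R\<close>, the lists of length \<open>k\<close> over \<open>R\<close>, are relevant; positions are counted from \<open>0\<close>.
  Replacing the \<open>i\<close>-th argument is written \<open>a[i := x]\<close>: the old entry \<open>a ! i\<close> then plays no role.
\<close>

definition set_ext :: "('a list \<Rightarrow> 'a set) \<Rightarrow> 'a set list \<Rightarrow> 'a set" where
  "set_ext f As = (\<Union>xs\<in>listset As. f xs)"

definition perm_invariant :: "nat \<Rightarrow> 'a set \<Rightarrow> ('a list \<Rightarrow> 'b) \<Rightarrow> bool" where
  "perm_invariant k R h \<longleftrightarrow> (\<forall>xs\<in>nlists k R. \<forall>ys. mset ys = mset xs \<longrightarrow> h ys = h xs)"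

definition hyper_assoc :: "nat \<Rightarrow> 'a set \<Rightarrow> ('a list \<Rightarrow> 'a set) \<Rightarrow> bool" where
  "hyper_assoc m R f \<longleftrightarrow>
    (\<forall>xs\<in>nlists (2 * m - 1) R. \<forall>i<m. \<forall>j<m.
      set_ext f (map (\<lambda>x. {x}) (take i xs) @ [f (take m (drop i xs))]
                 @ map (\<lambda>x. {x}) (drop (i + m) xs)) =
      set_ext f (map (\<lambda>x. {x}) (take j xs) @ [f (take m (drop j xs))]
                 @ map (\<lambda>x. {x}) (drop (j + m) xs)))"

definition op_assoc :: "nat \<Rightarrow> 'a set \<Rightarrow> ('a list \<Rightarrow> 'a) \<Rightarrow> bool" where
  "op_assoc n R g \<longleftrightarrow>
    (\<forall>xs\<in>nlists (2 * n - 1) R. \<forall>i<n. \<forall>j<n.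
      g (take i xs @ [g (take n (drop i xs))] @ drop (i + n) xs) =
      g (take j xs @ [g (take n (drop j xs))] @ drop (j + n) xs))"

definition is_zero :: "nat \<Rightarrow> 'a set \<Rightarrow> ('a list \<Rightarrow> 'a set) \<Rightarrow> 'a \<Rightarrow> bool" where
  "is_zero m R f z \<longleftrightarrow> z \<in> R \<and> (\<forall>x\<in>R. f (x # replicate (m - 1) z) = {x})"

definition hzero :: "nat \<Rightarrow> 'a set \<Rightarrow> ('a list \<Rightarrow> 'a set) \<Rightarrow> 'a" where
  "hzero m R f = (THE z. is_zero m R f z)"

definition is_neg :: "nat \<Rightarrow> 'a set \<Rightarrow> ('a list \<Rightarrow> 'a set) \<Rightarrow> 'a \<Rightarrow> 'a \<Rightarrow> bool" where
  "is_neg m R f x y \<longleftrightarrow>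
    y \<in> R \<and> hzero m R f \<in> f (x # y # replicate (m - 2) (hzero m R f))"

definition hneg :: "nat \<Rightarrow> 'a set \<Rightarrow> ('a list \<Rightarrow> 'a set) \<Rightarrow> 'a \<Rightarrow> 'a" where
  "hneg m R f x = (THE y. is_neg m R f x y)"

locale canonical_hypergroup =
  fixes m :: nat and R :: "'a set" and f :: "'a list \<Rightarrow> 'a set"
  assumes m_ge_2: "2 \<le> m"
    and f_closed: "\<forall>xs\<in>nlists m R. f xs \<noteq> {} \<and> f xs \<subseteq> R"
    and f_perm: "perm_invariant m R f"
    and f_assoc: "hyper_assoc m R f"
    and f_solvable: "\<forall>a\<in>nlists m R. \<forall>b\<in>R. \<forall>i<m. \<exists>x\<in>R. b \<in> f (a[i := x])"
    and ex1_zero: "\<exists>!z. is_zero m R f z"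
    and ex1_neg: "\<forall>x\<in>R. \<exists>!y. is_neg m R f x y"
    and f_reversible: "\<forall>xs\<in>nlists m R. \<forall>x\<in>f xs. \<forall>i<m.
      xs ! i \<in> f (x # map (hneg m R f) (take i xs @ drop (Suc i) xs))"

locale krasner_hyperring = canonical_hypergroup m R f
  for m n :: nat and R :: "'a set" and f :: "'a list \<Rightarrow> 'a set" and g :: "'a list \<Rightarrow> 'a" +
  assumes n_ge_2: "2 \<le> n"
    and g_closed: "\<forall>xs\<in>nlists n R. g xs \<in> R"
    and g_perm: "perm_invariant n R g"
    and g_assoc: "op_assoc n R g"
    and g_distrib: "\<forall>a\<in>nlists n R. \<forall>i<n. \<forall>xs\<in>nlists m R.
      (\<lambda>y. g (a[i := y])) ` f xs = f (map (\<lambda>y. g (a[i := y])) xs)"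
    and g_zero: "\<forall>xs\<in>nlists (n - 1) R. g (hzero m R f # xs) = hzero m R f"

definition scalar_identity :: "nat \<Rightarrow> 'a set \<Rightarrow> ('a list \<Rightarrow> 'a) \<Rightarrow> 'a \<Rightarrow> bool" where
  "scalar_identity n R g e \<longleftrightarrow> e \<in> R \<and> (\<forall>x\<in>R. g (x # replicate (n - 1) e) = x)"

definition subhypergroup :: "nat \<Rightarrow> ('a list \<Rightarrow> 'a set) \<Rightarrow> 'a set \<Rightarrow> bool" where
  "subhypergroup m f I \<longleftrightarrow>
    (\<forall>xs\<in>nlists m I. f xs \<subseteq> I) \<and>
    (\<forall>a\<in>nlists m I. \<forall>b\<in>I. \<forall>i<m. \<exists>x\<in>I. b \<in> f (a[i := x]))"

definition hyperideal ::
  "nat \<Rightarrow> nat \<Rightarrow> 'a set \<Rightarrow> ('a list \<Rightarrow> 'a set) \<Rightarrow> ('a list \<Rightarrow> 'a) \<Rightarrow> 'a set \<Rightarrow> bool" where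
  "hyperideal m n R f g I \<longleftrightarrow>
    I \<noteq> {} \<and> I \<subseteq> R \<and> subhypergroup m f I \<and>
    (\<forall>xs\<in>nlists n R. \<forall>i<n. \<forall>a\<in>I. g (xs[i := a]) \<in> I)"

definition multiplicative_subset :: "nat \<Rightarrow> 'a set \<Rightarrow> ('a list \<Rightarrow> 'a) \<Rightarrow> 'a set \<Rightarrow> bool" where
  "multiplicative_subset n R g S \<longleftrightarrow> S \<noteq> {} \<and> S \<subseteq> R \<and> (\<forall>ss\<in>nlists n S. g ss \<in> S)"

definition S_prime_hyperideal ::
  "nat \<Rightarrow> nat \<Rightarrow> 'a set \<Rightarrow> ('a list \<Rightarrow> 'a set) \<Rightarrow> ('a list \<Rightarrow> 'a) \<Rightarrow> 'a \<Rightarrow> 'a set \<Rightarrow> 'a set \<Rightarrow> bool"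
where
  "S_prime_hyperideal m n R f g e S I \<longleftrightarrow>
    hyperideal m n R f g I \<and> I \<inter> S = {} \<and>
    (\<exists>s\<in>S. \<forall>xs\<in>nlists n R. g xs \<in> I \<longrightarrow>
      (\<exists>i<n. g (s # xs ! i # replicate (n - 2) e) \<in> I))"

end

theory Submission
  imports Defs
begin

text \<open>
  For the forward direction, elements \<open>a\<^sub>i \<in> I\<^sub>i\<close> witnessing that no \<open>g(s, I\<^sub>i, 1, \<dots>, 1)\<close> lies in
  \<open>I\<close> would contradict \<open>S\<close>-primeness, since \<open>g(a\<^sub>1, \<dots>, a\<^sub>n) \<in> I\<close>. Conversely, in the presence of a
  scalar identity, \<open>{g(r, x, 1, \<dots>, 1) | r \<in> R}\<close> is a hyperideal containing \<open>x\<close>, and if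
  \<open>g(x\<^sub>1, \<dots>, x\<^sub>n) \<in> I\<close>, then the product of the hyperideals obtained from the \<open>x\<^sub>i\<close> is contained in
  \<open>I\<close>: replacing \<open>x\<^sub>i\<close> by \<open>g(r, x\<^sub>i, 1, \<dots>, 1)\<close> multiplies the whole product by \<open>r\<close>.
\<close>

lemma listset_iff_list_all2: "xs \<in> listset As \<longleftrightarrow> list_all2 (\<in>) xs As"
  by (induction As arbitrary: xs) (auto simp: set_Cons_def list_all2_Cons2)

lemma listset_replicate_singleton: "listset (replicate k {x}) = {replicate k x}"
  by (induction k) (auto simp: set_Cons_def)

text \<open>Used in both directions of the theorem to trade an inclusion of the set product of
  \<open>s\<close>, \<open>J\<close> and copies of \<open>e\<close> in \<open>I\<close> for a
  condition on single elements of \<open>J\<close>.\<close>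

lemma listset_scaled:
  "listset ({s} # J # replicate k {e}) = (\<lambda>a. s # a # replicate k e) ` J"
  by (auto simp: listset_replicate_singleton set_Cons_def)

text \<open>
  These rules rewrite \<open>length xs\<close> and \<open>set xs\<close> under a premise with unknown \<open>n\<close> and \<open>A\<close>; the
  simplifier can diverge on it when \<open>xs\<close> is of the form \<open>y # ys\<close>.
\<close>
declare nlistsE_length [simp del] nlistsE_set [simp del]

context krasner_hyperring
begin

lemma g_mset_cong: "xs \<in> nlists n R \<Longrightarrow> mset ys = mset xs \<Longrightarrow> g ys = g xs"
  using g_perm unfolding perm_invariant_def by blast

lemma g_in_R: "xs \<in> nlists n R \<Longrightarrow> g xs \<in> R"
  using g_closed by blast

lemma pair_in_nlists:
  "a \<in> R \<Longrightarrow> b \<in> R \<Longrightarrow> e \<in> R \<Longrightarrow> a # b # replicate (n - 2) e \<in> nlists n R"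
  using n_ge_2 by (intro nlistsI) (simp_all add: set_replicate_conv_if)

lemma hyperideal_mult_pair:
  assumes "hyperideal m n R f g I" "r \<in> R" "a \<in> I" "e \<in> R"
  shows "g (r # a # replicate (n - 2) e) \<in> I"
proof -
  have "a \<in> R" using assms(1,3) unfolding hyperideal_def by blast
  hence "r # a # replicate (n - 2) e \<in> nlists n R"
    using assms by (intro pair_in_nlists)
  moreover have "1 < n" using n_ge_2 by simp
  ultimately have "g ((r # a # replicate (n - 2) e)[1 := a]) \<in> I"
    using assms(1,3) unfolding hyperideal_def by blast
  thus ?thesis by simp
qed

text \<open>Permutation invariance brings the updated entry to the front; associativity then
  regroups \<open>y\<close> with the remaining entries, so that the factor \<open>r\<close> leaves
  the product.\<close>

lemma g_update_pair:
  assumes xs: "xs \<in> nlists n R" and i: "i < n" and "r \<in> R" "y \<in> R" "e \<in> R"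
  shows "g (xs[i := g (r # y # replicate (n - 2) e)]) =
    g (r # g (xs[i := y]) # replicate (n - 2) e)"
proof -
  define zs where "zs = take i xs @ drop (Suc i) xs"
  have len: "length xs = n" and sub: "set xs \<subseteq> R" using xs by (auto simp: nlists_def)
  have lz: "length zs = n - 1" using len i by (auto simp: zs_def)
  have sz: "set zs \<subseteq> R"
    using sub by (auto simp: zs_def dest: in_set_takeD in_set_dropD)
  have upd: "g (xs[i := z]) = g (z # zs)" if "z \<in> R" for z
  proof (rule g_mset_cong)
    show "z # zs \<in> nlists n R" using that lz sz n_ge_2 by (auto simp: nlists_def)
    show "mset (xs[i := z]) = mset (z # zs)"
      using i len by (simp add: zs_def upd_conv_take_nth_drop)
  qed
  define w where "w = r # replicate (n - 2) e"
  have lw: "length w = n - 1" using n_ge_2 by (simp add: w_def)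
  \<comment> \<open>Here \<open>y\<close> has index \<open>n - 1\<close>: it ends the first block of
    \<open>n\<close> entries and begins the last one. Associativity equates the bracketings of these
    two blocks.\<close>
  have "w @ y # zs \<in> nlists (2 * n - 1) R"
    using assms lz sz lw n_ge_2 by (auto simp: nlists_def w_def)
  hence "g (take 0 (w @ y # zs) @ [g (take n (drop 0 (w @ y # zs)))] @ drop (0 + n) (w @ y # zs))
    = g (take (n - 1) (w @ y # zs) @ [g (take n (drop (n - 1) (w @ y # zs)))]
        @ drop (n - 1 + n) (w @ y # zs))"
    using n_ge_2 by (intro g_assoc[unfolded op_assoc_def, rule_format]) auto
  moreover have "take n (w @ y # zs) = w @ [y]" "drop n (w @ y # zs) = zs"
    using lw n_ge_2 by (auto simp: take_Cons' drop_Cons')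
  moreover have "take (n - 1) (w @ y # zs) = w" "drop (n - 1) (w @ y # zs) = y # zs"
    "take n (y # zs) = y # zs" "drop (n - 1 + n) (w @ y # zs) = []"
    using lw lz n_ge_2 by auto
  ultimately have assoc: "g (g (w @ [y]) # zs) = g (w @ [g (y # zs)])"
    by (simp only: take_0 drop_0 add_0 append_Nil append_Cons append_Nil2)
  have w1: "g (w @ [z]) = g (r # z # replicate (n - 2) e)" if "z \<in> R" for z
    using pair_in_nlists[of r z e] assms that by (intro g_mset_cong) (auto simp: w_def)
  have "g (y # zs) \<in> R" using assms lz sz n_ge_2 by (intro g_in_R) (auto simp: nlists_def)
  moreover have "g (r # y # replicate (n - 2) e) \<in> R"
    using assms by (intro g_in_R pair_in_nlists)
  ultimately show ?thesis using assoc w1 upd assms(4) by metis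
qed

definition principal :: "'a \<Rightarrow> 'a \<Rightarrow> 'a set" where
  "principal e x = (\<lambda>r. g (r # x # replicate (n - 2) e)) ` R"

text \<open>By distributivity, multiplication by \<open>x\<close> commutes with \<open>f\<close>, so
  closure and solvability pass from \<open>R\<close> to its image. Absorption comes from
  \<open>g_update_pair\<close>.\<close>

lemma hyperideal_principal:
  assumes "e \<in> R" "x \<in> R"
  shows "hyperideal m n R f g (principal e x)"
proof -
  define h where "h r = g (r # x # replicate (n - 2) e)" for r
  have P: "principal e x = h ` R" by (simp add: principal_def h_def)
  have hR: "h r \<in> R" if "r \<in> R" for r
    unfolding h_def using assms that by (intro g_in_R pair_in_nlists)
  have dist: "h ` f rs = f (map h rs)" if "rs \<in> nlists m R" for rs
  proof -
    \<comment> \<open>The leading \<open>e\<close> is a placeholder: distributivity is applied in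
      argument \<open>0\<close>, where it is overwritten.\<close>
    have "e # x # replicate (n - 2) e \<in> nlists n R" "0 < n"
      using assms pair_in_nlists n_ge_2 by auto
    from g_distrib[rule_format, OF this that] show ?thesis by (simp add: h_def[abs_def])
  qed
  have lift: "\<exists>rs\<in>nlists k R. xs = map h rs" if "xs \<in> nlists k (h ` R)" for k xs
  proof -
    have "xs \<in> map h ` lists R" and "length xs = k"
      using that unfolding lists_image[symmetric] by (simp_all add: nlists_def lists_eq_set)
    thus ?thesis unfolding nlists_def by fastforce
  qed
  have "f xs \<subseteq> h ` R" if xs: "xs \<in> nlists m (h ` R)" for xs
  proof -
    obtain rs where rs: "rs \<in> nlists m R" "xs = map h rs" using lift[OF xs] by blast
    thus ?thesis using dist[OF rs(1)] f_closed by blast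
  qed
  moreover have "\<exists>z\<in>h ` R. b \<in> f (a[i := z])"
    if a: "a \<in> nlists m (h ` R)" and b: "b \<in> h ` R" and i: "i < m" for a b i
  proof -
    obtain rs where rs: "rs \<in> nlists m R" "a = map h rs" using lift[OF a] by blast
    obtain q where q: "q \<in> R" "b = h q" using b by blast
    obtain t where t: "t \<in> R" "q \<in> f (rs[i := t])" using f_solvable rs(1) q(1) i by blast
    have "rs[i := t] \<in> nlists m R" using rs(1) t(1) by simp
    hence "b \<in> f (map h (rs[i := t]))" using dist q t(2) by blast
    thus ?thesis using t(1) rs(2) by (auto simp: map_update)
  qed
  moreover have "g (xs[i := a]) \<in> h ` R"
    if xs: "xs \<in> nlists n R" and i: "i < n" and a: "a \<in> h ` R" for xs i a
  proof -
    obtain r where r: "r \<in> R" "a = h r" using a by blast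
    \<comment> \<open>With the two factors swapped, \<open>x\<close> becomes the scalar that
      \<open>g_update_pair\<close> pulls out, and what remains is \<open>h\<close> of a product in
      \<open>R\<close>.\<close>
    have sw: "h q = g (x # q # replicate (n - 2) e)" if "q \<in> R" for q
      unfolding h_def using assms that by (intro g_mset_cong pair_in_nlists) auto
    have *: "g (xs[i := r]) \<in> R"
      using xs r(1) by (intro g_in_R) simp
    have "g (xs[i := a]) = g (x # g (xs[i := r]) # replicate (n - 2) e)"
      using g_update_pair[OF xs i assms(2) r(1) assms(1)] r sw by simp
    also have "\<dots> = h (g (xs[i := r]))" using sw * by simp
    finally show ?thesis using * by blast
  qed
  ultimately show ?thesis
    unfolding hyperideal_def subhypergroup_def P
    using assms(1) hR by (intro conjI ballI allI impI image_subsetI) auto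
qed

lemma mem_principal:
  assumes "scalar_identity n R g e" "x \<in> R"
  shows "x \<in> principal e x"
proof -
  have e: "e \<in> R" and 1: "g (x # replicate (n - 1) e) = x"
    using assms by (auto simp: scalar_identity_def)
  have "n - 1 = Suc (n - 2)" using n_ge_2 by simp
  hence "x # replicate (n - 1) e = x # e # replicate (n - 2) e" by simp
  \<comment> \<open>The multiplier that yields \<open>x\<close> itself is \<open>e\<close>.\<close>
  hence "g (e # x # replicate (n - 2) e) = x"
    using g_mset_cong[OF pair_in_nlists[OF assms(2) e e], of "e # x # replicate (n - 2) e"] 1
    by simp
  thus ?thesis unfolding principal_def using e by force
qed

text \<open>The entries of \<open>xs\<close> are exchanged for those of \<open>ys\<close> from left
  to right; each exchange multiplies the product by an element of \<open>R\<close>, which keeps it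
  in \<open>I\<close>.\<close>

lemma g_listset_principal_subset:
  assumes I: "hyperideal m n R f g I" and e: "e \<in> R"
    and xs: "xs \<in> nlists n R" and gx: "g xs \<in> I"
  shows "g ` listset (map (principal e) xs) \<subseteq> I"
proof (rule image_subsetI)
  fix ys assume "ys \<in> listset (map (principal e) xs)"
  hence ys: "length ys = n" "\<And>i. i < n \<Longrightarrow> ys ! i \<in> principal e (xs ! i)"
    using xs by (auto simp: listset_iff_list_all2 list_all2_conv_all_nth nlists_def)
  have len: "length xs = n" and sub: "set xs \<subseteq> R" using xs by (auto simp: nlists_def)
  have x: "xs ! i \<in> R" if "i < n" for i using that len sub by auto
  have "set ys \<subseteq> R"
    using ys x hyperideal_principal[OF e] by (fastforce simp: set_conv_nth hyperideal_def)
  have "g (take k ys @ drop k xs) \<in> I" if "k \<le> n" for k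
    using that
  proof (induction k)
    case 0
    thus ?case using gx by simp
  next
    case (Suc k)
    define zs where "zs = take k ys @ drop k xs"
    have k: "k < n" using Suc.prems by simp
    have zs: "zs \<in> nlists n R"
      using k len sub ys(1) \<open>set ys \<subseteq> R\<close>
      by (auto simp: zs_def nlists_def dest: in_set_takeD in_set_dropD)
    obtain r where r: "r \<in> R" "ys ! k = g (r # xs ! k # replicate (n - 2) e)"
      using ys(2)[OF k] by (auto simp: principal_def)
    have "take (Suc k) ys @ drop (Suc k) xs = zs[k := ys ! k]"
      using k len ys(1) by (intro nth_equalityI) (auto simp: zs_def nth_append nth_list_update)
    \<comment> \<open>This trivial update gives \<open>zs\<close> the shape that
      \<open>g_update_pair\<close> produces for \<open>y = xs ! k\<close>.\<close>
    moreover have "zs[k := xs ! k] = zs"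
      using k len ys(1) by (intro nth_equalityI) (auto simp: zs_def nth_append nth_list_update)
    ultimately have "g (take (Suc k) ys @ drop (Suc k) xs) = g (r # g zs # replicate (n - 2) e)"
      using g_update_pair[OF zs k r(1) x[OF k] e] r(2) by simp
    moreover have "g zs \<in> I" using Suc by (simp add: zs_def)
    ultimately show ?case using hyperideal_mult_pair[OF I r(1) _ e] by simp
  qed
  from this[of n] show "g ys \<in> I" using ys(1) len by simp
qed

end

theorem theorem3p7:
  fixes m n :: nat and R :: "'a set" and f :: "'a list \<Rightarrow> 'a set" and g :: "'a list \<Rightarrow> 'a"
    and e :: 'a and S I :: "'a set"
  assumes "krasner_hyperring m n R f g"
    and "scalar_identity n R g e"
    and "multiplicative_subset n R g S"
    and "hyperideal m n R f g I"
    and "I \<inter> S = {}"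
  shows "S_prime_hyperideal m n R f g e S I \<longleftrightarrow>
    (\<exists>s\<in>S. \<forall>Is\<in>nlists n {J. hyperideal m n R f g J}.
      g ` listset Is \<subseteq> I \<longrightarrow>
      (\<exists>i<n. g ` listset ({s} # Is ! i # replicate (n - 2) {e}) \<subseteq> I))"
proof -
  interpret krasner_hyperring m n R f g by fact
  have e: "e \<in> R" using assms(2) by (simp add: scalar_identity_def)
  \<comment> \<open>The equivalence holds for each fixed \<open>s\<close>, so the same witness
    serves on both sides.\<close>
  have "(\<forall>xs\<in>nlists n R. g xs \<in> I \<longrightarrow> (\<exists>i<n. g (s # xs ! i # replicate (n - 2) e) \<in> I)) \<longleftrightarrow>
    (\<forall>Is\<in>nlists n {J. hyperideal m n R f g J}. g ` listset Is \<subseteq> I \<longrightarrow>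
      (\<exists>i<n. g ` listset ({s} # Is ! i # replicate (n - 2) {e}) \<subseteq> I))"
    (is "?elts \<longleftrightarrow> ?ideals") for s
  proof
    assume elts: ?elts
    show ?ideals
    proof (intro ballI impI, rule ccontr)
      fix Is assume Is: "Is \<in> nlists n {J. hyperideal m n R f g J}" and sub: "g ` listset Is \<subseteq> I"
        and "\<not> (\<exists>i<n. g ` listset ({s} # Is ! i # replicate (n - 2) {e}) \<subseteq> I)"
      hence "\<forall>i<n. \<exists>a\<in>Is ! i. g (s # a # replicate (n - 2) e) \<notin> I"
        by (auto simp: listset_scaled simp del: listset.simps)
      then obtain a where a: "\<And>i. i < n \<Longrightarrow> a i \<in> Is ! i"
          "\<And>i. i < n \<Longrightarrow> g (s # a i # replicate (n - 2) e) \<notin> I"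
        by metis
      define xs where "xs = map a [0..<n]"
      have len: "length Is = n" using Is by (simp add: nlists_def)
      have "Is ! i \<subseteq> R" if "i < n" for i
        using nlistsE_nth_in[OF Is that] by (simp add: hyperideal_def)
      hence "xs \<in> nlists n R" using a(1) by (fastforce simp: xs_def nlists_def)
      moreover have "xs \<in> listset Is"
        using a(1) len by (simp add: xs_def listset_iff_list_all2 list_all2_conv_all_nth)
      ultimately obtain i where "i < n" "g (s # xs ! i # replicate (n - 2) e) \<in> I"
        using elts sub by blast
      thus False using a(2) by (simp add: xs_def)
    qed
  next
    assume ideals: ?ideals
    show ?elts
    proof (intro ballI impI)
      fix xs assume xs: "xs \<in> nlists n R" and gx: "g xs \<in> I"
      have len: "length xs = n" and R: "set xs \<subseteq> R" using xs by (auto simp: nlists_def)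
      have "map (principal e) xs \<in> nlists n {J. hyperideal m n R f g J}"
        using len R hyperideal_principal[OF e] by (auto simp: nlists_def)
      then obtain i where i: "i < n"
          "g ` listset ({s} # map (principal e) xs ! i # replicate (n - 2) {e}) \<subseteq> I"
        using ideals g_listset_principal_subset[OF assms(4) e xs gx] by blast
      \<comment> \<open>The inclusion for the whole principal hyperideal is evaluated at its
        generator.\<close>
      have "xs ! i \<in> principal e (xs ! i)"
        using mem_principal[OF assms(2)] i(1) len R nth_mem by blast
      thus "\<exists>i<n. g (s # xs ! i # replicate (n - 2) e) \<in> I"
        using i len by (auto simp: listset_scaled simp del: listset.simps)
    qed
  qed
  thus ?thesis using assms(4,5) by (simp add: S_prime_hyperideal_def)
qed

end
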